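(* Let $X\subseteq \mathbb{R}$. (a) If $X$ is uniformly locally finite, then there is a constant $\varepsilon>0$ such that whenever $G\subseteq \mathbb{R}$ is a Lebesgue measurable set with $\lambda(G)<\varepsilon$, then the set $\{a \in \mathbb{R}: (a+X) \subseteq (\mathbb{R} \setminus G)\}$ has infinite Lebesgue measure. (b) If $X$ is not uniformly locally finite, then for every $\varepsilon>0$ there is an open set $G\subseteq \mathbb{R}$ with $\lambda(G)<\varepsilon$ such that $(a+X) \cap G$ is infinite for each $a \in \mathbb{R}$; equivalently, its complement $\mathbb{R} \setminus G$ does not contain any translation copy of $X \setminus K$, for any finite set $K$.
   Context: $\lambda$ denotes (outer) Lebesgue measure on $\mathbb{R}$. A set $X \subseteq \mathbb{R}$ is called uniformly locally finite if $\sup\{\operatorname{card}(X\cap [u, u+1]): u\in\mathbb{R}\} < \infty$. A translation copy of a set $Y\subseteq\mathbb{R}$ is a set $a+Y=\{a+y:y\in Y\}$ with $a\in\mathbb{R}$. *)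

theory Defs
  imports "HOL-Analysis.Analysis"
begin

(* Since card of an infinite set is 0, finiteness is demanded separately; the supremum of the
   cardinalities (counted in the extended naturals) is finite iff both conjuncts hold. *)
definition uniformly_locally_finite :: "real set \<Rightarrow> bool" where
  "uniformly_locally_finite X \<longleftrightarrow>
     (\<forall>u. finite (X \<inter> {u..u + 1})) \<and> bdd_above (range (\<lambda>u. card (X \<inter> {u..u + 1})))"

definition translation_copy :: "real set \<Rightarrow> real set \<Rightarrow> bool" where
  "translation_copy Y Z \<longleftrightarrow> (\<exists>a. Z = (\<lambda>y. a + y) ` Y)"

end

theory Submission
  imports Defs
begin

text \<open>
  (a) The translation \<open>a\<close> is bad iff \<open>a\<close> lies in some \<open>G - x\<close> with \<open>x \<in> X\<close>. If every unit interval
  contains at most \<open>N\<close> points of \<open>X\<close>, every point of \<open>G\<close> lies in \<open>[x + u, x + u + 1]\<close> for at most \<open>N\<close>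
  points \<open>x\<close>, so the bad set has measure at most \<open>N \<lambda>(G)\<close> in each unit interval \<open>[u, u + 1]\<close>. With
  \<open>\<epsilon> = 1 / (2 N)\<close> at least half of every unit interval is good.

  (b) Let \<open>F\<close> be a set of \<open>n\<close> points in a unit interval. Rounded to a grid of sufficiently small mesh
  \<open>1 / m\<close> it becomes \<open>A \<subseteq> {0..m}\<close> with \<open>n\<close> elements. By averaging, some \<open>b\<close> lies in \<open>i + A\<close> for a
  proportion at least \<open>n / (2 m + 1)\<close> of any set of indices \<open>i \<le> m\<close>; choosing such \<open>b\<close> greedily \<open>\<delta> m\<close> times
  leaves a proportion \<open>exp (- n \<delta> / 3)\<close> of the indices, which are then treated one by one. So \<open>O(\<delta> m)\<close>
  grid cells meet all translates of \<open>F\<close> by a unit interval if \<open>n\<close> is large. If \<open>X\<close> is not uniformly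
  locally finite, apply this to pairwise disjoint finite sets \<open>F\<^sub>k \<subseteq> X\<close> with error
  \<open>\<epsilon> / 2^(k+2)\<close>, taking every integer unit interval of translations infinitely often.
\<close>

subsection \<open>Translates avoiding a set of small measure\<close>

lemma emeasure_lebesgue_translation:
  fixes a :: "'a::euclidean_space"
  shows "emeasure lebesgue ((\<lambda>x. a + x) ` S) = emeasure lebesgue S"
  using emeasure_lebesgue_affine[of 1 a S] by (simp add: add.commute cong: image_cong_simp)

text \<open>The integer unit intervals from \<open>- r\<close> to \<open>r\<close> cover the set.
  This presents \<open>X\<close> as an increasing union of finite sets, for which the measure
  estimate can be summed.\<close>

lemma finite_Int_if_uniformly_locally_finite:
  assumes "uniformly_locally_finite X"
  shows "finite (X \<inter> {- real r..real r})"
proof (rule finite_subset)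
  show "X \<inter> {- real r..real r} \<subseteq> (\<Union>i\<in>{- int r..int r}. X \<inter> {real_of_int i..real_of_int i + 1})"
  proof
    fix x assume x: "x \<in> X \<inter> {- real r..real r}"
    then have "- int r \<le> \<lfloor>x\<rfloor>" "\<lfloor>x\<rfloor> \<le> int r"
      by (auto simp: le_floor_iff floor_le_iff)
    moreover have "x \<in> {real_of_int \<lfloor>x\<rfloor>..real_of_int \<lfloor>x\<rfloor> + 1}"
      using of_int_floor_le[of x] real_of_int_floor_add_one_ge[of x] by simp
    ultimately show "x \<in> (\<Union>i\<in>{- int r..int r}. X \<inter> {real_of_int i..real_of_int i + 1})"
      using x by (intro UN_I[of "\<lfloor>x\<rfloor>"]) auto
  qed
  show "finite (\<Union>i\<in>{- int r..int r}. X \<inter> {real_of_int i..real_of_int i + 1})"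
    using assms by (intro finite_UN_I) (auto simp: uniformly_locally_finite_def)
qed

text \<open>Double counting: after subadditivity the sum of measures is the integral over
  \<open>G\<close> of the number of \<open>x\<close> whose window \<open>[x + u, x + u + 1]\<close>
  contains the given point, and that number is at most \<open>N\<close>.\<close>

lemma emeasure_UN_translates_le_finite:
  fixes X :: "real set"
  assumes fin: "finite X" and N: "\<And>v. card (X \<inter> {v..v + 1}) \<le> N"
    and G: "G \<in> sets lebesgue"
  shows "emeasure lebesgue ((\<Union>x\<in>X. (\<lambda>y. - x + y) ` G) \<inter> {u..u + 1}) \<le> N * emeasure lebesgue G"
proof -
  \<comment> \<open>Cutting to the window before applying subadditivity keeps the loss at
    \<open>N\<close> instead of \<open>card X\<close>.\<close>
  have shift: "(\<lambda>y. - x + y) ` G \<inter> {u..u + 1} = (\<lambda>y. - x + y) ` (G \<inter> {x + u..x + u + 1})" for x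
    by (auto simp: image_iff algebra_simps)
  have meas: "G \<inter> {x + u..x + u + 1} \<in> sets lebesgue" for x
    using G by (intro sets.Int) auto
  have "emeasure lebesgue ((\<Union>x\<in>X. (\<lambda>y. - x + y) ` G) \<inter> {u..u + 1})
      = emeasure lebesgue (\<Union>x\<in>X. (\<lambda>y. - x + y) ` (G \<inter> {x + u..x + u + 1}))"
    unfolding shift[symmetric] by (rule arg_cong[where f = "emeasure lebesgue"]) blast
  also have "\<dots> \<le> (\<Sum>x\<in>X. emeasure lebesgue ((\<lambda>y. - x + y) ` (G \<inter> {x + u..x + u + 1})))"
    using fin meas by (intro emeasure_subadditive_finite image_subsetI lebesgue_sets_translation)
  also have "\<dots> = (\<Sum>x\<in>X. emeasure lebesgue (G \<inter> {x + u..x + u + 1}))"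
    by (simp only: emeasure_lebesgue_translation)
  also have "\<dots> = (\<Sum>x\<in>X. \<integral>\<^sup>+ y. indicator (G \<inter> {x + u..x + u + 1}) y \<partial>lebesgue)"
    using meas by simp
  also have "\<dots> = (\<integral>\<^sup>+ y. (\<Sum>x\<in>X. indicator (G \<inter> {x + u..x + u + 1}) y) \<partial>lebesgue)"
    using meas by (intro nn_integral_sum[symmetric] borel_measurable_indicator)
  also have "\<dots> \<le> (\<integral>\<^sup>+ y. of_nat N * indicator G y \<partial>lebesgue)"
  proof (rule nn_integral_mono)
    fix y :: real
    have "(\<Sum>x\<in>X. indicator (G \<inter> {x + u..x + u + 1}) y :: ennreal)
        = of_nat (card {x \<in> X. y \<in> G \<inter> {x + u..x + u + 1}})"
      using fin by (simp add: indicator_def sum.If_cases Int_def)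
    also have "\<dots> \<le> of_nat N * indicator G y"
    proof (cases "y \<in> G")
      case True
      then have "{x \<in> X. y \<in> G \<inter> {x + u..x + u + 1}} = X \<inter> {y - u - 1..(y - u - 1) + 1}"
        by auto
      then show ?thesis using N[of "y - u - 1"] True by simp
    qed auto
    finally show "(\<Sum>x\<in>X. indicator (G \<inter> {x + u..x + u + 1}) y :: ennreal) \<le> of_nat N * indicator G y" .
  qed
  also have "\<dots> = N * emeasure lebesgue G"
    using G by (simp add: nn_integral_cmult_indicator)
  finally show ?thesis .
qed

text \<open>The finite case passes to the limit: truncating \<open>X\<close> to
  \<open>[- r, r]\<close> gives an increasing sequence of measurable sets with union
  \<open>Y\<close>, and the bound does not depend on \<open>r\<close>.\<close>

lemma emeasure_UN_translates_le:
  assumes X: "uniformly_locally_finite X" and N: "\<And>v. card (X \<inter> {v..v + 1}) \<le> N"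
    and G: "G \<in> sets lebesgue"
  defines "Y \<equiv> \<Union>x\<in>X. (\<lambda>y. - x + y) ` G"
  shows "Y \<in> sets lebesgue" "emeasure lebesgue (Y \<inter> {u..u + 1}) \<le> N * emeasure lebesgue G"
proof -
  define Yr where "Yr r = (\<Union>x\<in>X \<inter> {- real r..real r}. (\<lambda>y. - x + y) ` G)" for r
  have Yr: "Yr r \<in> sets lebesgue" for r
    unfolding Yr_def using finite_Int_if_uniformly_locally_finite[OF X] G
    by (intro sets.finite_UN lebesgue_sets_translation)
  have arch: "\<exists>r. x \<in> {- real r..real r}" for x :: real
    using real_arch_simple[of "\<bar>x\<bar>"] by (auto simp: abs_le_iff minus_le_iff)
  have YU: "Y = (\<Union>r. Yr r)"
  proof
    show "Y \<subseteq> (\<Union>r. Yr r)"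
    proof
      fix a assume "a \<in> Y"
      then obtain x where x: "x \<in> X" "a \<in> (\<lambda>y. - x + y) ` G" unfolding Y_def by blast
      obtain r where "x \<in> {- real r..real r}" using arch by blast
      then have "a \<in> Yr r" using x unfolding Yr_def by blast
      then show "a \<in> (\<Union>r. Yr r)" by blast
    qed
  qed (auto simp: Y_def Yr_def)
  then show "Y \<in> sets lebesgue" using Yr by auto
  have "emeasure lebesgue (Y \<inter> {u..u + 1}) = emeasure lebesgue (\<Union>r. Yr r \<inter> {u..u + 1})"
    by (simp add: YU)
  also have "\<dots> = (SUP r. emeasure lebesgue (Yr r \<inter> {u..u + 1}))"
    by (rule SUP_emeasure_incseq[symmetric])
      (use Yr in \<open>fastforce simp: incseq_def Yr_def\<close>)+
  also have "\<dots> \<le> N * emeasure lebesgue G"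
  proof (rule SUP_least)
    fix r
    have "card (X \<inter> {- real r..real r} \<inter> {v..v + 1}) \<le> N" for v
      using X N[of v] unfolding uniformly_locally_finite_def
      by (meson card_mono dual_order.trans inf_le1 inf_mono order_refl)
    then show "emeasure lebesgue (Yr r \<inter> {u..u + 1}) \<le> N * emeasure lebesgue G"
      unfolding Yr_def using emeasure_UN_translates_le_finite finite_Int_if_uniformly_locally_finite[OF X] G by blast
  qed
  finally show "emeasure lebesgue (Y \<inter> {u..u + 1}) \<le> N * emeasure lebesgue G" .
qed

text \<open>Half-open intervals are disjoint, so the contributions add up exactly and the measure
  exceeds every multiple of \<open>c\<close>.\<close>

lemma emeasure_infinite_if_unit_intervals:
  assumes S: "S \<in> sets lebesgue" and "c > 0"
    and c: "\<And>k::nat. ennreal c \<le> emeasure lebesgue (S \<inter> {real k..<real k + 1})"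
  shows "emeasure lebesgue S = \<infinity>"
proof (rule ccontr)
  assume "emeasure lebesgue S \<noteq> \<infinity>"
  then obtain r where r: "r \<ge> 0" "emeasure lebesgue S = ennreal r"
    by (metis ennreal_cases infinity_ennreal_def)
  have le: "ennreal (k * c) \<le> emeasure lebesgue (S \<inter> {0..<real k})" for k :: nat
  proof (induction k)
    case (Suc k)
    have "ennreal (Suc k * c) = ennreal (k * c) + ennreal c"
      using \<open>c > 0\<close> by (simp add: algebra_simps flip: ennreal_plus)
    also have "\<dots> \<le> emeasure lebesgue (S \<inter> {0..<real k}) + emeasure lebesgue (S \<inter> {real k..<real k + 1})"
      using Suc c by (intro add_mono)
    also have "\<dots> = emeasure lebesgue ((S \<inter> {0..<real k}) \<union> (S \<inter> {real k..<real k + 1}))"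
      using S by (intro plus_emeasure) auto
    also have "(S \<inter> {0..<real k}) \<union> (S \<inter> {real k..<real k + 1}) = S \<inter> {0..<real (Suc k)}"
      by auto
    finally show ?case .
  qed simp
  obtain k :: nat where "r / c < k" using reals_Archimedean2 by blast
  then have "r < k * c" using \<open>c > 0\<close> by (simp add: field_simps)
  moreover have "ennreal (k * c) \<le> ennreal r"
    using le[of k] emeasure_mono[of "S \<inter> {0..<real k}" S lebesgue] S r(2) by auto
  ultimately show False using r(1) by simp
qed

lemma translates_avoiding_infinite_measure:
  assumes X: "uniformly_locally_finite X"
  shows "\<exists>\<epsilon>>0. \<forall>G. G \<in> sets lebesgue \<and> emeasure lebesgue G < ennreal \<epsilon> \<longrightarrow>
    emeasure lebesgue {a::real. (\<lambda>x. a + x) ` X \<subseteq> UNIV - G} = \<infinity>"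
proof -
  obtain M where M: "\<And>v. card (X \<inter> {v..v + 1}) \<le> M"
    using X by (auto simp: uniformly_locally_finite_def bdd_above_def)
  \<comment> \<open>\<open>M\<close> may be 0, as for empty \<open>X\<close>; the maximum keeps
    \<open>1 / (2 * N)\<close> positive.\<close>
  define N where "N = max 1 M"
  have N: "card (X \<inter> {v..v + 1}) \<le> N" for v using M[of v] by (simp add: N_def)
  have N1: "N \<ge> 1" by (simp add: N_def)
  show ?thesis
  proof (intro exI[of _ "1 / (2 * real N)"] conjI allI impI)
    show "1 / (2 * real N) > 0" using N1 by simp
  next
    fix G :: "real set" assume asm: "G \<in> sets lebesgue \<and> emeasure lebesgue G < ennreal (1 / (2 * real N))"
    define Y where "Y = (\<Union>x\<in>X. (\<lambda>y. - x + y) ` G)"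
    have Y: "Y \<in> sets lebesgue" "\<And>u. emeasure lebesgue (Y \<inter> {u..u + 1}) \<le> N * emeasure lebesgue G"
      unfolding Y_def using emeasure_UN_translates_le[OF X N] asm by auto
    have eq: "{a. (\<lambda>x. a + x) ` X \<subseteq> UNIV - G} = UNIV - Y"
      by (force simp: Y_def image_iff)
    have "emeasure lebesgue (UNIV - Y) = \<infinity>"
    proof (rule emeasure_infinite_if_unit_intervals[where c = "1 / 2"])
      fix k :: nat
      have "N * emeasure lebesgue G \<le> ennreal N * ennreal (1 / (2 * real N))"
        using asm by (intro mult_mono) (auto simp: ennreal_of_nat_eq_real_of_nat)
      also have "\<dots> = ennreal (1 / 2)" using N1 by (simp flip: ennreal_mult)
      finally have half: "N * emeasure lebesgue G \<le> ennreal (1 / 2)" .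
      \<comment> \<open>The interval splits into a good and a bad part; the bad one has measure at
        most \<open>1 / 2\<close>, which is cancelled at the end.\<close>
      have "ennreal (1 / 2) + ennreal (1 / 2) = emeasure lebesgue {real k..<real k + 1}"
        using ennreal_plus[of "1 / 2" "1 / 2"] by simp
      also have "\<dots> = emeasure lebesgue (((UNIV - Y) \<inter> {real k..<real k + 1}) \<union> (Y \<inter> {real k..<real k + 1}))"
        by (rule arg_cong[where f = "emeasure lebesgue"]) auto
      also have "\<dots> \<le> emeasure lebesgue ((UNIV - Y) \<inter> {real k..<real k + 1})
          + emeasure lebesgue (Y \<inter> {real k..<real k + 1})"
        using Y(1) by (intro emeasure_subadditive sets.Int) auto
      also have "emeasure lebesgue (Y \<inter> {real k..<real k + 1}) \<le> emeasure lebesgue (Y \<inter> {real k..real k + 1})"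
        using Y(1) by (intro emeasure_mono) auto
      also have "\<dots> \<le> ennreal (1 / 2)" using Y(2) half by (rule order_trans)
      finally show "ennreal (1 / 2) \<le> emeasure lebesgue ((UNIV - Y) \<inter> {real k..<real k + 1})"
        by (simp add: add_left_mono)
    qed (use Y(1) in auto)
    then show "emeasure lebesgue {a::real. (\<lambda>x. a + x) ` X \<subseteq> UNIV - G} = \<infinity>"
      by (simp only: eq)
  qed
qed

subsection \<open>Greedy covers\<close>

text \<open>Counting the pairs related by \<open>R\<close> in two ways, an average \<open>b\<close>
  is related to at least \<open>card U * n / card T\<close> elements of \<open>U\<close>, so some
  \<open>b\<close> does as well as the average.\<close>

lemma greedy_cover_step:
  fixes R :: "'a \<Rightarrow> 'b \<Rightarrow> bool"
  assumes fU: "finite U" and fT: "finite T" and T: "T \<noteq> {}"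
    and n: "\<And>u. u \<in> U \<Longrightarrow> n \<le> card {b \<in> T. R u b}"
  obtains b where "b \<in> T"
    "real (card {u \<in> U. \<not> R u b}) \<le> real (card U) * (1 - n / card T)"
proof -
  have cT: "card T > 0" using fT T by (simp add: card_gt_0_iff)
  have "\<exists>b\<in>T. real (card {u \<in> U. \<not> R u b}) \<le> real (card U) * (1 - n / card T)"
  proof (rule ccontr)
    assume "\<not> ?thesis"
    then have less: "real (card {u \<in> U. \<not> R u b}) > real (card U) * (1 - n / card T)" if "b \<in> T" for b
      using that by force
    have split: "card {u \<in> U. R u b} + card {u \<in> U. \<not> R u b} = card U" for b
    proof -
      have "card ({u \<in> U. R u b} \<union> {u \<in> U. \<not> R u b}) = card {u \<in> U. R u b} + card {u \<in> U. \<not> R u b}"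
        using fU by (intro card_Un_disjoint) auto
      moreover have "{u \<in> U. R u b} \<union> {u \<in> U. \<not> R u b} = U" by auto
      ultimately show ?thesis by simp
    qed
    have "real (card {u \<in> U. R u b}) < real (card U) * n / card T" if "b \<in> T" for b
    proof -
      have "real (card {u \<in> U. R u b}) + real (card {u \<in> U. \<not> R u b}) = real (card U)"
        using split[of b] by (metis of_nat_add)
      then show ?thesis using less[OF that] by (simp add: algebra_simps)
    qed
    then have "(\<Sum>b\<in>T. real (card {u \<in> U. R u b})) < (\<Sum>b\<in>T. real (card U) * n / card T)"
      using fT T by (intro sum_strict_mono) auto
    also have "\<dots> = real (card U * n)" using cT by simp
    also have "\<dots> \<le> (\<Sum>u\<in>U. real (card {b \<in> T. R u b}))"
      using sum_mono[of U "\<lambda>_. n" "\<lambda>u. card {b \<in> T. R u b}"] n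
      by (simp flip: of_nat_sum of_nat_mult del: of_nat_mult of_nat_sum)
    also have "\<dots> = (\<Sum>b\<in>T. real (card {u \<in> U. R u b}))"
      using sum_multicount_gen[OF fU fT, of R "\<lambda>b. card {u \<in> U. R u b}"]
      by (simp flip: of_nat_sum)
    finally show False by simp
  qed
  then show ?thesis using that by blast
qed

text \<open>Each further choice is made for the elements still uncovered. Since
  \<open>n \<le> card T\<close>, the factor is nonnegative and the estimates multiply.\<close>

lemma greedy_cover_iterate:
  fixes R :: "'a \<Rightarrow> 'b \<Rightarrow> bool"
  assumes "finite U" "finite T" "T \<noteq> {}"
    and "\<And>u. u \<in> U \<Longrightarrow> n \<le> card {b \<in> T. R u b}" and "n \<le> card T"
  shows "\<exists>B\<subseteq>T. card B \<le> t \<and>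
    real (card {u \<in> U. \<forall>b\<in>B. \<not> R u b}) \<le> real (card U) * (1 - n / card T) ^ t"
proof (induction t)
  case 0
  show ?case by (intro exI[of _ "{}"]) auto
next
  case (Suc t)
  then obtain B where B: "B \<subseteq> T" "card B \<le> t"
    "real (card {u \<in> U. \<forall>b\<in>B. \<not> R u b}) \<le> real (card U) * (1 - n / card T) ^ t"
    by blast
  obtain b where b: "b \<in> T"
    "real (card {u \<in> {u \<in> U. \<forall>b\<in>B. \<not> R u b}. \<not> R u b})
      \<le> real (card {u \<in> U. \<forall>b\<in>B. \<not> R u b}) * (1 - n / card T)"
    by (rule greedy_cover_step[of "{u \<in> U. \<forall>b\<in>B. \<not> R u b}" T n R]) (use assms in auto)
  have nn: "0 \<le> 1 - n / card T"
    using assms(2,3,5) by (simp add: divide_le_eq_1 card_gt_0_iff)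
  have "{u \<in> U. \<forall>c\<in>insert b B. \<not> R u c} = {u \<in> {u \<in> U. \<forall>b\<in>B. \<not> R u b}. \<not> R u b}" by auto
  then have "real (card {u \<in> U. \<forall>c\<in>insert b B. \<not> R u c}) \<le> real (card U) * (1 - n / card T) ^ Suc t"
    using b(2) mult_right_mono[OF B(3) nn] by (simp add: mult_ac)
  moreover have "card (insert b B) \<le> Suc t"
    using B(1,2) assms(2) by (metis card_insert_le_m1 diff_Suc_1 zero_less_Suc)
  ultimately show ?case using B(1) b(1) by (intro exI[of _ "insert b B"]) auto
qed

text \<open>The first summand of the bound counts the greedy choices. The second bounds the set
  \<open>V\<close> that they miss, each element of which receives its own
  \<open>f u\<close>.\<close>

lemma greedy_cover:
  fixes R :: "'a \<Rightarrow> 'b \<Rightarrow> bool"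
  assumes "finite U" "finite T" "T \<noteq> {}"
    and n: "\<And>u. u \<in> U \<Longrightarrow> n \<le> card {b \<in> T. R u b}" and "n \<le> card T" and "n > 0"
  obtains B where "B \<subseteq> T" "\<And>u. u \<in> U \<Longrightarrow> \<exists>b\<in>B. R u b"
    "real (card B) \<le> t + real (card U) * (1 - n / card T) ^ t"
proof -
  obtain B where B: "B \<subseteq> T" "card B \<le> t"
    "real (card {u \<in> U. \<forall>b\<in>B. \<not> R u b}) \<le> real (card U) * (1 - n / card T) ^ t"
    using greedy_cover_iterate[of U T n R t] assms by auto
  define V where "V = {u \<in> U. \<forall>b\<in>B. \<not> R u b}"
  have "\<exists>b\<in>T. R u b" if "u \<in> U" for u
  proof -
    have "card {b \<in> T. R u b} > 0" using n[OF that] \<open>n > 0\<close> by linarith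
    then show ?thesis by (auto simp: card_gt_0_iff)
  qed
  then obtain f where f: "\<And>u. u \<in> U \<Longrightarrow> f u \<in> T \<and> R u (f u)" by metis
  have "card (B \<union> f ` V) \<le> card B + card (f ` V)" by (rule card_Un_le)
  also have "\<dots> \<le> t + card V"
    using B(2) card_image_le[of V f] assms(1) by (auto simp: V_def intro: add_mono)
  finally have "real (card (B \<union> f ` V)) \<le> t + real (card V)" by linarith
  also have "\<dots> \<le> t + real (card U) * (1 - n / card T) ^ t" using B(3) by (simp add: V_def)
  finally have card: "real (card (B \<union> f ` V)) \<le> t + real (card U) * (1 - n / card T) ^ t" .
  have "\<exists>b\<in>B \<union> f ` V. R u b" if "u \<in> U" for u
    using f that by (cases "u \<in> V") (auto simp: V_def)
  then show ?thesis
    using B(1) f card by (intro that[of "B \<union> f ` V"]) (auto simp: V_def)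
qed

subsection \<open>Small open sets meeting all translates\<close>

text \<open>The greedy cover is applied to the shifts \<open>i + A\<close> inside
  \<open>{0..2 * m}\<close> with \<open>t\<close> about \<open>\<delta> * m\<close>. The 4 arises
  from \<open>t \<le> 2 * \<delta> * m\<close> and at most
  \<open>(m + 1) * \<delta> \<le> 2 * m * \<delta>\<close> leftover indices.\<close>

lemma grid_sumset_cover:
  fixes A :: "nat set" and \<delta> :: real
  assumes A: "A \<subseteq> {0..m}" and "A \<noteq> {}" and \<delta>: "\<delta> > 0" and m: "1 \<le> \<delta> * m"
    and exp: "exp (- (card A * \<delta> / 3)) \<le> \<delta>"
  obtains B where "finite B" "\<And>i. i \<le> m \<Longrightarrow> \<exists>j\<in>A. i + j \<in> B" "real (card B) \<le> 4 * \<delta> * m"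
proof -
  define n where "n = card A"
  define t where "t = nat \<lceil>\<delta> * m\<rceil>"
  have t: "\<delta> * m \<le> t" "t \<le> \<delta> * m + 1"
    using m by (auto simp: t_def)
  have m1: "m \<ge> 1" using m by (cases m) auto
  have fA: "finite A" using A finite_subset by blast
  have "n \<le> card {0..m}" unfolding n_def using A by (intro card_mono) auto
  then have n: "n > 0" "n \<le> 2 * m + 1"
    using fA \<open>A \<noteq> {}\<close> by (auto simp: n_def card_gt_0_iff)
  have cn: "n \<le> card {b \<in> {0..2 * m}. \<exists>j\<in>A. b = i + j}" if "i \<in> {0..m}" for i
  proof -
    have "{b \<in> {0..2 * m}. \<exists>j\<in>A. b = i + j} = (\<lambda>j. i + j) ` A"
      using A that by fastforce
    then show ?thesis by (simp add: card_image n_def)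
  qed
  obtain B where B: "B \<subseteq> {0..2 * m}" "\<And>i. i \<in> {0..m} \<Longrightarrow> \<exists>b\<in>B. \<exists>j\<in>A. b = i + j"
    "real (card B) \<le> t + real (card {0..m}) * (1 - n / card {0..2 * m}) ^ t"
    by (rule greedy_cover[of "{0..m}" "{0..2 * m}" n "\<lambda>i b. \<exists>j\<in>A. b = i + j" t])
      (use n cn in auto)
  have "(1 - n / (2 * m + 1)) ^ t \<le> exp (- (n / (2 * m + 1))) ^ t"
    using n exp_ge_add_one_self[of "- (n / (2 * m + 1))"]
    by (intro power_mono) (auto simp: field_simps)
  also have "\<dots> = exp (- (n * (t / (2 * m + 1))))"
    by (simp flip: exp_of_nat_mult)
  also have "\<dots> \<le> exp (- (n * \<delta> / 3))"
  proof -
    \<comment> \<open>The 3 in the exponent comes from \<open>2 * m + 1 \<le> 3 * m\<close>.\<close>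
    have "\<delta> / 3 \<le> \<delta> * m / (2 * m + 1)" using m1 \<delta> by (simp add: field_simps)
    also have "\<dots> \<le> t / (2 * m + 1)" using t(1) by (intro divide_right_mono) auto
    finally have "n * (\<delta> / 3) \<le> n * (t / (2 * m + 1))" by (intro mult_left_mono) auto
    then show ?thesis by simp
  qed
  also have "\<dots> \<le> \<delta>" using exp by (simp add: n_def)
  finally have pow: "(1 - n / (2 * m + 1)) ^ t \<le> \<delta>" .
  have "real (card B) \<le> t + (m + 1) * (1 - n / (2 * m + 1)) ^ t" using B(3) by (simp add: add_ac)
  also have "\<dots> \<le> (\<delta> * m + \<delta> * m) + (2 * m) * \<delta>"
  proof (rule add_mono)
    show "real t \<le> \<delta> * m + \<delta> * m" using t(2) m by linarith
    have "real (m + 1) * (1 - n / (2 * m + 1)) ^ t \<le> real (m + 1) * \<delta>"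
      using pow by (intro mult_left_mono) auto
    also have "\<dots> \<le> real (2 * m) * \<delta>" using m1 \<delta> by (intro mult_right_mono) auto
    finally show "real (m + 1) * (1 - n / (2 * m + 1)) ^ t \<le> real (2 * m) * \<delta>" .
  qed
  finally have "real (card B) \<le> 4 * \<delta> * m" by (simp add: algebra_simps)
  moreover have "finite B" using B(1) finite_subset by blast
  moreover have "\<exists>j\<in>A. i + j \<in> B" if "i \<le> m" for i
    using B(2)[of i] that by auto
  ultimately show ?thesis using that by blast
qed

lemma finite_separated:
  fixes F :: "'a::metric_space set"
  assumes "finite F"
  obtains d where "d > 0" "\<And>x y. x \<in> F \<Longrightarrow> y \<in> F \<Longrightarrow> x \<noteq> y \<Longrightarrow> d \<le> dist x y"
proof -
  \<comment> \<open>The extra 1 keeps \<open>D\<close> nonempty when \<open>F\<close> has at most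
    one point.\<close>
  define D where "D = insert 1 ((\<lambda>(x, y). dist x y) ` {(x, y) \<in> F \<times> F. x \<noteq> y})"
  have fin: "finite D"
    unfolding D_def using assms by (auto intro: finite_subset[of _ "F \<times> F"])
  have "Min D > 0"
    using fin by (subst Min_gr_iff) (auto simp: D_def)
  moreover have "Min D \<le> dist x y" if "x \<in> F" "y \<in> F" "x \<noteq> y" for x y
    using fin that by (intro Min_le) (auto simp: D_def)
  ultimately show ?thesis using that by blast
qed

lemma nat_floor_bounds:
  fixes c :: real
  assumes "0 \<le> c" "c \<le> 1"
  shows "nat \<lfloor>real m * c\<rfloor> \<le> m" "real (nat \<lfloor>real m * c\<rfloor>) \<le> real m * c"
    "real m * c < real (nat \<lfloor>real m * c\<rfloor>) + 1"
proof -
  have "real m * c \<le> real m" using assms by (simp add: mult_left_le)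
  moreover have "0 \<le> real m * c" using assms by simp
  ultimately show "nat \<lfloor>real m * c\<rfloor> \<le> m" "real (nat \<lfloor>real m * c\<rfloor>) \<le> real m * c"
    "real m * c < real (nat \<lfloor>real m * c\<rfloor>) + 1"
    by linarith+
qed

text \<open>The threshold \<open>N\<close> depends on \<open>\<epsilon>\<close> alone; only the mesh
  \<open>1 / m\<close> depends on the spacing of \<open>F\<close>. Thus a large number of points
  suffices, however close together they are.\<close>

lemma small_open_set_hit_by_translates:
  fixes \<epsilon> :: real
  assumes "\<epsilon> > 0"
  shows "\<exists>N. \<forall>F (u::real) z. finite F \<and> N \<le> card F \<and> F \<subseteq> {u..u + 1} \<longrightarrow>
    (\<exists>G. open G \<and> emeasure lebesgue G < ennreal \<epsilon> \<and> (\<forall>a\<in>{z..z + 1}. \<exists>x\<in>F. a + x \<in> G))"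
proof -
  \<comment> \<open>At most \<open>4 * \<delta> * m\<close> intervals of length \<open>3 / m\<close>
    have total length at most \<open>12 * \<delta> = \<epsilon> / 2\<close>.\<close>
  define \<delta> where "\<delta> = \<epsilon> / 24"
  have \<delta>: "\<delta> > 0" using assms by (simp add: \<delta>_def)
  \<comment> \<open>This makes \<open>exp (- n * \<delta> / 3) \<le> \<delta>\<close> for all
    \<open>n \<ge> N0\<close>. The threshold used is \<open>Suc N0\<close>, so that \<open>F\<close>
    is nonempty even if \<open>N0 = 0\<close>.\<close>
  obtain N0 :: nat where N0: "- ln \<delta> * 3 / \<delta> < N0" using reals_Archimedean2 by blast
  have "\<exists>G. open G \<and> emeasure lebesgue G < ennreal \<epsilon> \<and> (\<forall>a\<in>{z..z + 1}. \<exists>x\<in>F. a + x \<in> G)"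
    if F: "finite F" "Suc N0 \<le> card F" "F \<subseteq> {u..u + 1}" for F and u z :: real
  proof -
    obtain d where d: "d > 0" "\<And>x y. x \<in> F \<Longrightarrow> y \<in> F \<Longrightarrow> x \<noteq> y \<Longrightarrow> d \<le> dist x y"
      using finite_separated[OF F(1)] by blast
    \<comment> \<open>A mesh below the separation \<open>d\<close> makes rounding injective on
      \<open>F\<close>, so no points are lost.\<close>
    obtain m :: nat where m: "max (1 / \<delta>) (1 / d) < m" using reals_Archimedean2 by blast
    have m\<delta>: "1 \<le> \<delta> * m" and md: "1 \<le> d * m"
      using m \<delta> d(1) by (auto simp: field_simps)
    have m0: "m > 0" using m\<delta> by (cases m) auto
    define p where "p x = nat \<lfloor>real m * (x - u)\<rfloor>" for x
    have p: "p x \<le> m" "real (p x) \<le> real m * (x - u)" "real m * (x - u) < real (p x) + 1"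
      if "x \<in> F" for x
      unfolding p_def using nat_floor_bounds[of "x - u" m] F(3) that by auto
    have inj: "inj_on p F"
    proof (rule inj_onI, rule ccontr)
      fix x y assume xy: "x \<in> F" "y \<in> F" "p x = p y" "x \<noteq> y"
      have "\<bar>real m * (x - u) - real m * (y - u)\<bar> < 1"
        using p[OF xy(1)] p[OF xy(2)] xy(3) by linarith
      then have "m * dist x y < 1"
        by (simp add: dist_real_def right_diff_distrib[symmetric] abs_mult)
      moreover have "m * d \<le> m * dist x y"
        using d(2)[OF xy(1,2,4)] by (intro mult_left_mono) auto
      ultimately show False using md by (simp add: mult.commute)
    qed
    have card: "card (p ` F) = card F" using inj by (rule card_image)
    have "- ln \<delta> * 3 / \<delta> < card F" using N0 F(2) by linarith
    then have "- (card F * \<delta> / 3) \<le> ln \<delta>" using \<delta> by (simp add: field_simps)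
    then have exp: "exp (- (card (p ` F) * \<delta> / 3)) \<le> \<delta>"
      using \<delta> by (metis card exp_le_cancel_iff exp_ln)
    have ne: "p ` F \<noteq> {}" using F(2) by auto
    have sub: "p ` F \<subseteq> {0..m}" using p(1) by auto
    obtain B where B: "finite B" "\<And>i. i \<le> m \<Longrightarrow> \<exists>j\<in>p ` F. i + j \<in> B" "real (card B) \<le> 4 * \<delta> * m"
      using grid_sumset_cover[OF sub ne \<delta> m\<delta> exp] by blast
    \<comment> \<open>Rounding down both \<open>a\<close> and \<open>x\<close> puts
      \<open>m * (a + x - (z + u))\<close> into \<open>[b, b + 2)\<close> with
      \<open>b = i + p x\<close>; the extra cell on the left makes room for an open
      interval.\<close>
    define J where "J b = {(real b - 1) / m + (z + u)<..<(real b + 2) / m + (z + u)}" for b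
    define G where "G = (\<Union>b\<in>B. J b)"
    have "open G" by (auto simp: G_def J_def)
    moreover have "emeasure lebesgue G < ennreal \<epsilon>"
    proof -
      have "emeasure lebesgue G \<le> (\<Sum>b\<in>B. emeasure lebesgue (J b))"
        unfolding G_def using B(1) by (intro emeasure_subadditive_finite) (auto simp: J_def)
      also have "\<dots> = (\<Sum>b\<in>B. ennreal (3 / m))"
      proof (intro sum.cong refl)
        fix b
        have "(real b - 1) / m + (z + u) \<le> (real b + 2) / m + (z + u)"
          by (intro add_right_mono divide_right_mono) auto
        then have "emeasure lebesgue (J b) = ennreal ((real b + 2) / m + (z + u) - ((real b - 1) / m + (z + u)))"
          by (simp add: J_def)
        also have "(real b + 2) / m + (z + u) - ((real b - 1) / m + (z + u)) = 3 / m"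
          using m0 by (simp add: field_simps)
        finally show "emeasure lebesgue (J b) = ennreal (3 / m)" .
      qed
      also have "\<dots> = ennreal (card B * (3 / m))"
        by (simp add: ennreal_of_nat_eq_real_of_nat flip: ennreal_mult)
      also have "\<dots> < ennreal \<epsilon>"
      proof (rule ennreal_lessI[OF assms])
        have "card B * (3 / m) \<le> 4 * \<delta> * m * (3 / m)" using B(3) by (intro mult_right_mono) auto
        also have "\<dots> = \<epsilon> / 2" using m0 by (simp add: \<delta>_def)
        finally show "card B * (3 / m) < \<epsilon>" using assms by simp
      qed
      finally show ?thesis .
    qed
    moreover have "\<exists>x\<in>F. a + x \<in> G" if "a \<in> {z..z + 1}" for a
    proof -
      define i where "i = nat \<lfloor>real m * (a - z)\<rfloor>"
      have i: "i \<le> m" "real i \<le> real m * (a - z)" "real m * (a - z) < real i + 1"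
        unfolding i_def using nat_floor_bounds[of "a - z" m] that by auto
      obtain x where x: "x \<in> F" "i + p x \<in> B" using B(2)[OF i(1)] by auto
      have "real (i + p x) - 1 < m * (a + x - (z + u))" "m * (a + x - (z + u)) < real (i + p x) + 2"
        using i(2,3) p(2,3)[OF x(1)] m0 by (auto simp: algebra_simps)
      then have "(real (i + p x) - 1) / m < a + x - (z + u)" "a + x - (z + u) < (real (i + p x) + 2) / m"
        using m0 by (simp_all add: pos_divide_less_eq pos_less_divide_eq mult.commute)
      then have "a + x \<in> J (i + p x)" by (simp add: J_def)
      then show ?thesis using x by (auto simp: G_def)
    qed
    ultimately show ?thesis by blast
  qed
  then show ?thesis by blast
qed

text \<open>If all windows are finite, their cardinalities are unbounded and removing
  \<open>S\<close> costs at most \<open>card S\<close>; otherwise an infinite window stays infinite.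
  Avoiding \<open>S\<close> later makes the chosen pieces disjoint.\<close>

lemma not_uniformly_locally_finite_large_subset:
  assumes X: "\<not> uniformly_locally_finite X" and S: "finite S"
  obtains F u where "finite F" "N \<le> card F" "F \<subseteq> X - S" "F \<subseteq> {u..u + 1}"
proof (cases "\<forall>u. finite (X \<inter> {u..u + 1})")
  case True
  then have "\<not> bdd_above (range (\<lambda>u. card (X \<inter> {u..u + 1})))"
    using X by (simp add: uniformly_locally_finite_def)
  then obtain u where "N + card S < card (X \<inter> {u..u + 1})"
    by (auto simp: bdd_above_def not_le)
  moreover have "card (X \<inter> {u..u + 1}) - card S \<le> card (X \<inter> {u..u + 1} - S)"
    using S by (rule diff_card_le_card_Diff)
  ultimately have "N \<le> card (X \<inter> {u..u + 1} - S)" by linarith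
  then show ?thesis
    using True by (intro that[of "X \<inter> {u..u + 1} - S" u]) auto
next
  case False
  then obtain u where "infinite (X \<inter> {u..u + 1})" by blast
  then have "infinite (X \<inter> {u..u + 1} - S)" using S by simp
  then obtain F where "finite F" "card F = N" "F \<subseteq> X \<inter> {u..u + 1} - S"
    by (metis infinite_arbitrarily_large)
  then show ?thesis by (intro that[of F u]) auto
qed

lemma small_open_set_meeting_translates:
  assumes X: "\<not> uniformly_locally_finite X" and \<epsilon>: "\<epsilon> > 0"
  obtains G where "open G" "emeasure lebesgue G < ennreal \<epsilon>" "\<And>a. infinite ((\<lambda>x. a + x) ` X \<inter> G)"
proof -
  \<comment> \<open>The ignored second component of the pair makes \<open>z\<close> take every
    integer value infinitely often.\<close>
  define z :: "nat \<Rightarrow> int" where "z k = int_decode (fst (prod_decode k))" for k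
  \<comment> \<open>The errors sum to \<open>\<epsilon> / 2\<close>, since countable subadditivity
    alone would not preserve the strict inequality.\<close>
  define e where "e k = \<epsilon> / 2 * (1 / 2) ^ Suc k" for k
  define good where "good S k F G \<longleftrightarrow> finite F \<and> F \<subseteq> X - S \<and> open G \<and> emeasure lebesgue G < ennreal (e k)
      \<and> (\<forall>a\<in>{real_of_int (z k)..real_of_int (z k) + 1}. \<exists>x\<in>F. a + x \<in> G)" for S k F G
  have "\<exists>F G. good S k F G" if S: "finite S" for S k
  proof -
    have "e k > 0" using \<epsilon> by (simp add: e_def)
    then obtain N where N: "\<And>F (u::real) z. finite F \<and> N \<le> card F \<and> F \<subseteq> {u..u + 1} \<Longrightarrow>
      \<exists>G. open G \<and> emeasure lebesgue G < ennreal (e k) \<and> (\<forall>a\<in>{z..z + 1}. \<exists>x\<in>F. a + x \<in> G)"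
      using small_open_set_hit_by_translates[of "e k"] by blast
    obtain F u where F: "finite F" "N \<le> card F" "F \<subseteq> X - S" "F \<subseteq> {u..u + 1}"
      using not_uniformly_locally_finite_large_subset[OF X S] by metis
    moreover obtain G where "open G" "emeasure lebesgue G < ennreal (e k)"
      "\<forall>a\<in>{real_of_int (z k)..real_of_int (z k) + 1}. \<exists>x\<in>F. a + x \<in> G"
      using N[OF conjI[OF F(1) conjI[OF F(2,4)]], of "real_of_int (z k)"] by blast
    ultimately show ?thesis unfolding good_def by blast
  qed
  \<comment> \<open>Choosing for all finite \<open>S\<close> at once turns the dependent choice into
    a recursion: \<open>S k\<close> collects the points used before stage \<open>k\<close>.\<close>
  then obtain f g where fg: "\<And>S k. finite S \<Longrightarrow> good S k (f S k) (g S k)"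
    by metis
  define S where "S = rec_nat {} (\<lambda>k T. T \<union> f T k)"
  have S_Suc: "S (Suc k) = S k \<union> f (S k) k" for k by (simp add: S_def)
  have finS: "finite (S k)" for k
  proof (induction k)
    case 0
    show ?case by (simp add: S_def)
  next
    case (Suc k)
    then show ?case using fg[of "S k" k] by (simp add: S_Suc good_def)
  qed
  define F where "F k = f (S k) k" for k
  define H where "H k = g (S k) k" for k
  have FH: "F k \<subseteq> X - S k" "open (H k)" "emeasure lebesgue (H k) < ennreal (e k)"
    "\<forall>a\<in>{real_of_int (z k)..real_of_int (z k) + 1}. \<exists>x\<in>F k. a + x \<in> H k" for k
    using fg[OF finS[of k], of k] unfolding F_def H_def good_def by blast+
  have "incseq S" by (rule incseq_SucI) (simp add: S_Suc)
  then have "F i \<subseteq> S j" if "i < j" for i j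
    using incseqD[of S "Suc i" j] that unfolding S_Suc F_def by auto
  then have "F i \<inter> F j = {}" if "i < j" for i j
    using FH(1)[of j] that by blast
  then have disj: "F i \<inter> F j = {}" if "i \<noteq> j" for i j
    using that by (metis inf_commute linorder_neqE_nat)
  show ?thesis
  proof (rule that)
    show "open (\<Union>k. H k)" using FH(2) by blast
    have "emeasure lebesgue (\<Union>k. H k) \<le> (\<Sum>k. emeasure lebesgue (H k))"
      using FH(2) by (intro emeasure_subadditive_countably) (auto intro: borel_open)
    also have "\<dots> \<le> (\<Sum>k. ennreal (e k))"
      using FH(3) by (intro suminf_le) (auto intro: less_imp_le)
    also have "\<dots> = ennreal (\<epsilon> / 2)"
    proof -
      have "e sums (\<epsilon> / 2 * 1)" unfolding e_def by (intro sums_mult power_half_series)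
      moreover have "0 \<le> e k" for k using \<epsilon> by (simp add: e_def)
      ultimately show ?thesis by (intro suminf_ennreal_eq) simp_all
    qed
    also have "\<dots> < ennreal \<epsilon>" using \<epsilon> by (intro ennreal_lessI) auto
    finally show "emeasure lebesgue (\<Union>k. H k) < ennreal \<epsilon>" .
  next
    fix a :: real
    define K where "K = {k. z k = \<lfloor>a\<rfloor>}"
    have "range (\<lambda>j. prod_encode (int_encode \<lfloor>a\<rfloor>, j)) \<subseteq> K"
      by (auto simp: K_def z_def)
    moreover have "infinite (range (\<lambda>j. prod_encode (int_encode \<lfloor>a\<rfloor>, j)))"
      by (intro range_inj_infinite injI) (simp add: prod_encode_eq)
    ultimately have K: "infinite K" using finite_subset by blast
    have "\<exists>x\<in>F k. a + x \<in> H k" if "k \<in> K" for k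
    proof -
      have "a \<in> {real_of_int (z k)..real_of_int (z k) + 1}" using that of_int_floor_le[of a] real_of_int_floor_add_one_ge[of a]
        by (simp add: K_def)
      then show ?thesis using FH(4)[of k] by blast
    qed
    then obtain x where x: "\<And>k. k \<in> K \<Longrightarrow> x k \<in> F k \<and> a + x k \<in> H k" by metis
    \<comment> \<open>The points \<open>x k\<close> lie in pairwise disjoint sets
      \<open>F k\<close>, so infinitely many stages give infinitely many hits.\<close>
    have "inj_on (\<lambda>k. a + x k) K"
    proof (rule inj_onI, rule ccontr)
      fix i j assume "i \<in> K" "j \<in> K" "a + x i = a + x j" "i \<noteq> j"
      then show False using x[of i] x[of j] disj[of i j] by auto
    qed
    then have "infinite ((\<lambda>k. a + x k) ` K)" using K finite_image_iff by blast
    moreover have "(\<lambda>k. a + x k) ` K \<subseteq> (\<lambda>x. a + x) ` X \<inter> (\<Union>k. H k)"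
      using x FH(1) by blast
    ultimately show "infinite ((\<lambda>x. a + x) ` X \<inter> (\<Union>k. H k))"
      using finite_subset by blast
  qed
qed

text \<open>For fixed \<open>a\<close>, a finite intersection yields \<open>K\<close> as the set of
  those \<open>x\<close> in \<open>X\<close> with \<open>a + x\<close> in \<open>G\<close>;
  conversely, once \<open>a + (X - K)\<close> avoids \<open>G\<close>, all hits lie in
  \<open>a + K\<close>.\<close>

lemma infinite_meet_translates_iff:
  "(\<forall>a::real. infinite ((\<lambda>x. a + x) ` X \<inter> G)) \<longleftrightarrow>
   (\<forall>K. finite K \<longrightarrow> \<not> (\<exists>Z. translation_copy (X - K) Z \<and> Z \<subseteq> UNIV - G))"
proof -
  have fin: "finite ((\<lambda>x. a + x) ` X \<inter> G) \<longleftrightarrow> (\<exists>K. finite K \<and> (\<lambda>x. a + x) ` (X - K) \<subseteq> UNIV - G)" for a :: real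
  proof
    assume "finite ((\<lambda>x. a + x) ` X \<inter> G)"
    moreover have "(\<lambda>x. a + x) ` {x \<in> X. a + x \<in> G} = (\<lambda>x. a + x) ` X \<inter> G" by blast
    ultimately have "finite ((\<lambda>x. a + x) ` {x \<in> X. a + x \<in> G})" by simp
    then have "finite {x \<in> X. a + x \<in> G}" by (rule finite_imageD) simp
    moreover have "(\<lambda>x. a + x) ` (X - {x \<in> X. a + x \<in> G}) \<subseteq> UNIV - G" by blast
    ultimately show "\<exists>K. finite K \<and> (\<lambda>x. a + x) ` (X - K) \<subseteq> UNIV - G" by blast
  next
    assume "\<exists>K. finite K \<and> (\<lambda>x. a + x) ` (X - K) \<subseteq> UNIV - G"
    then obtain K where K: "finite K" "(\<lambda>x. a + x) ` (X - K) \<subseteq> UNIV - G" by blast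
    then have "(\<lambda>x. a + x) ` X \<inter> G \<subseteq> (\<lambda>x. a + x) ` K" by blast
    then show "finite ((\<lambda>x. a + x) ` X \<inter> G)" using K(1) finite_subset by blast
  qed
  have copy: "(\<exists>Z. translation_copy Y Z \<and> Z \<subseteq> W) \<longleftrightarrow> (\<exists>a. (\<lambda>y. a + y) ` Y \<subseteq> W)" for Y W
    by (auto simp: translation_copy_def)
  show ?thesis unfolding fin copy by blast
qed

theorem theorem14:
  fixes X :: "real set"
  shows
    "(uniformly_locally_finite X \<longrightarrow>
        (\<exists>\<epsilon>::real. \<epsilon> > 0 \<and>
          (\<forall>G::real set. G \<in> sets lebesgue \<and> emeasure lebesgue G < ennreal \<epsilon> \<longrightarrow>
             emeasure lebesgue {a::real. (\<lambda>x. a + x) ` X \<subseteq> UNIV - G} = \<infinity>))) \<and>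
     (\<not> uniformly_locally_finite X \<longrightarrow>
        (\<forall>\<epsilon>::real. \<epsilon> > 0 \<longrightarrow>
          (\<exists>G::real set. open G \<and> emeasure lebesgue G < ennreal \<epsilon> \<and>
             (\<forall>a::real. infinite ((\<lambda>x. a + x) ` X \<inter> G)) \<and>
             (\<forall>K::real set. finite K \<longrightarrow>
                \<not> (\<exists>Z. translation_copy (X - K) Z \<and> Z \<subseteq> UNIV - G))) \<and>
          (\<forall>G::real set. open G \<and> emeasure lebesgue G < ennreal \<epsilon> \<longrightarrow>
             ((\<forall>a::real. infinite ((\<lambda>x. a + x) ` X \<inter> G)) \<longleftrightarrow>
              (\<forall>K::real set. finite K \<longrightarrow>
                 \<not> (\<exists>Z. translation_copy (X - K) Z \<and> Z \<subseteq> UNIV - G))))))"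
  (is "?A \<and> ?B")
proof
  show ?A
    using translates_avoiding_infinite_measure by blast
  show ?B
    \<comment> \<open>Both clauses about \<open>K\<close> become the clause about infinite
      intersections, so the equivalence is reduced to reflexivity.\<close>
    unfolding infinite_meet_translates_iff[symmetric]
  proof (intro impI allI conjI)
    fix \<epsilon> :: real
    assume X: "\<not> uniformly_locally_finite X" and \<epsilon>: "\<epsilon> > 0"
    show "\<exists>G. open G \<and> emeasure lebesgue G < ennreal \<epsilon> \<and>
        (\<forall>a. infinite ((\<lambda>x. a + x) ` X \<inter> G)) \<and> (\<forall>a. infinite ((\<lambda>x. a + x) ` X \<inter> G))"
      by (rule small_open_set_meeting_translates[OF X \<epsilon>]) blast
  qed (rule refl)
qed

end
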